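(* Let $X$ be a complex Banach space and let $M\subseteq X$ be a subset containing $0$ and stable under multiplication by the complex numbers of modulus one, regarded as a metric space with base point $0$ and with the action of the circle group $\mathbb T$ on $M$ induced by scalar multiplication in $X$. Then the map $\delta_{\mathbb C}\colon M\to\mathcal F_{\mathbb C}(M)$ is isometric. Moreover, for any complex Banach space $Y$ and any $\mathbb T$-equivariant Lipschitz map $L\colon M\to Y$ with $L(0)=0$, there is a factorization $L=\tilde L\,\delta_{\mathbb C}$ with a bounded linear operator $\tilde L\colon\mathcal F_{\mathbb C}(M)\to Y$ satisfying $\|\tilde L\|=\mathrm{Lip}(L)$.
   Context: For a metric space $M$ with base point $0$, $\mathrm{Lip}_0(M)$ is the Banach space of Lipschitz functions $f\colon M\to\mathbb R$ with $f(0)=0$, normed by the least Lipschitz constant $\mathrm{Lip}(f)$; $\delta\colon M\to \mathrm{Lip}_0(M)^*$ is given by $\langle f,\delta(m)\rangle=f(m)$; the (real) Lipschitz-free space is $\mathcal F(M)=\overline{\mathrm{span}}\,\delta(M)\subset \mathrm{Lip}_0(M)^*$. $\mathbb T$ is the unit circle as a multiplicative group. Given an isometric action of $\mathbb T$ on $M$ fixing $0$, put $$Y_{\mathbb T}=\overline{\mathrm{span}}\{\delta(e^{i\theta}.m)-\cos\theta\,\delta(m)-\sin\theta\,\delta(i.m):\ m\in M,\ \theta\in\mathbb R\}\subseteq\mathcal F(M),$$ and let $\mathcal F_{\mathbb C}(M)=\mathcal F(M)/Y_{\mathbb T}$ with the quotient norm. It is a complex Banach space with multiplication by $i$ determined by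 $i.(\delta(m)+Y_{\mathbb T})=\delta(i.m)+Y_{\mathbb T}$. Let $\pi_{\mathbb C}\colon\mathcal F(M)\to\mathcal F_{\mathbb C}(M)$ be the quotient map and $\delta_{\mathbb C}=\pi_{\mathbb C}\delta$. A map $L\colon M\to Y$ into a complex Banach space is $\mathbb T$-equivariant if $L(e^{i\theta}.m)=e^{i\theta}L(m)$ for all $m\in M$, $\theta\in\mathbb R$. *)

theory Defs
  imports
    "HOL-Analysis.Analysis"
    "HOL-Library.Function_Algebras"
    "HOL-Library.Set_Algebras"
begin

section \<open>Complex Banach spaces\<close>

class complex_normed_vector = real_normed_vector +
  fixes scaleC :: "complex \<Rightarrow> 'a \<Rightarrow> 'a"  (infixr \<open>*\<^sub>C\<close> 75)
  assumes scaleC_add_right: "c *\<^sub>C (x + y) = c *\<^sub>C x + c *\<^sub>C y"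
    and scaleC_add_left: "(c + d) *\<^sub>C x = c *\<^sub>C x + d *\<^sub>C x"
    and scaleC_scaleC: "c *\<^sub>C (d *\<^sub>C x) = (c * d) *\<^sub>C x"
    and scaleC_of_real: "complex_of_real r *\<^sub>C x = r *\<^sub>R x"
    and norm_scaleC: "norm (c *\<^sub>C x) = cmod c * norm x"

class cbanach = complex_normed_vector + complete_space

instantiation complex :: cbanach
begin
definition scaleC_complex :: "complex \<Rightarrow> complex \<Rightarrow> complex"
  where "scaleC_complex c x = c * x"
instance
  by standard (auto simp: scaleC_complex_def algebra_simps norm_mult scaleR_conv_of_real)
end


section \<open>Pointwise real vector space structure on functions\<close>

instantiation "fun" :: (type, scaleR) scaleR
begin
definition scaleR_fun :: "real \<Rightarrow> ('a \<Rightarrow> 'b) \<Rightarrow> 'a \<Rightarrow> 'b"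
  where "scaleR_fun r f = (\<lambda>x. r *\<^sub>R f x)"
instance ..
end

lemma scaleR_fun_apply [simp]: "(r *\<^sub>R f) x = r *\<^sub>R f x"
  by (simp add: scaleR_fun_def)

instance "fun" :: (type, real_vector) real_vector
  by standard (auto simp: fun_eq_iff scaleR_add_right scaleR_add_left)


section \<open>Lipschitz functions and the Lipschitz-free space\<close>

text \<open>A pointed metric space is given by a carrier set \<open>M\<close> in a type of class
  \<^class>\<open>metric_space\<close> and a base point \<open>z \<in> M\<close>.\<close>

definition lip_const :: "'m::metric_space set \<Rightarrow> ('m \<Rightarrow> 'b::metric_space) \<Rightarrow> real" where
  "lip_const M f = Inf {C. C-lipschitz_on M f}"

text \<open>A function on \<open>M\<close> is represented by its extension by zero to the whole type, so that
  distinct elements of \<open>lip0 M z\<close> are distinct functions on \<open>M\<close>. The same convention is used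
  for functionals on \<open>lip0 M z\<close>.\<close>

definition lip0 :: "'m::metric_space set \<Rightarrow> 'm \<Rightarrow> ('m \<Rightarrow> real) set" where
  "lip0 M z = {f. (\<exists>C. C-lipschitz_on M f) \<and> f z = 0 \<and> (\<forall>x. x \<notin> M \<longrightarrow> f x = 0)}"

definition lip_dual :: "'m::metric_space set \<Rightarrow> 'm \<Rightarrow> (('m \<Rightarrow> real) \<Rightarrow> real) set" where
  "lip_dual M z = {\<phi>.
     (\<forall>f\<in>lip0 M z. \<forall>g\<in>lip0 M z. \<phi> (f + g) = \<phi> f + \<phi> g) \<and>
     (\<forall>r. \<forall>f\<in>lip0 M z. \<phi> (r *\<^sub>R f) = r * \<phi> f) \<and>
     (\<exists>K. \<forall>f\<in>lip0 M z. \<bar>\<phi> f\<bar> \<le> K * lip_const M f) \<and>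
     (\<forall>f. f \<notin> lip0 M z \<longrightarrow> \<phi> f = 0)}"

definition dual_norm :: "'m::metric_space set \<Rightarrow> 'm \<Rightarrow> (('m \<Rightarrow> real) \<Rightarrow> real) \<Rightarrow> real" where
  "dual_norm M z \<phi> = (SUP f\<in>{f \<in> lip0 M z. lip_const M f \<le> 1}. \<bar>\<phi> f\<bar>)"

definition dual_closure ::
  "'m::metric_space set \<Rightarrow> 'm \<Rightarrow> (('m \<Rightarrow> real) \<Rightarrow> real) set \<Rightarrow> (('m \<Rightarrow> real) \<Rightarrow> real) set" where
  "dual_closure M z S =
     {\<phi> \<in> lip_dual M z. \<forall>\<epsilon>>0. \<exists>\<psi>\<in>S. dual_norm M z (\<phi> - \<psi>) < \<epsilon>}"

definition delta :: "'m::metric_space set \<Rightarrow> 'm \<Rightarrow> 'm \<Rightarrow> ('m \<Rightarrow> real) \<Rightarrow> real" where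
  "delta M z m = (\<lambda>f. if f \<in> lip0 M z then f m else 0)"

definition free_space :: "'m::metric_space set \<Rightarrow> 'm \<Rightarrow> (('m \<Rightarrow> real) \<Rightarrow> real) set" where
  "free_space M z = dual_closure M z (span (delta M z ` M))"


section \<open>The complex Lipschitz-free space of a circle action\<close>

text \<open>Only the values of \<open>act\<close> at complex numbers of modulus one and at points of \<open>M\<close> matter.\<close>

locale isometric_circle_action =
  fixes M :: "'m::metric_space set" and z :: 'm and act :: "complex \<Rightarrow> 'm \<Rightarrow> 'm"
  assumes base: "z \<in> M"
    and act_closed: "cmod c = 1 \<Longrightarrow> m \<in> M \<Longrightarrow> act c m \<in> M"
    and act_one: "m \<in> M \<Longrightarrow> act 1 m = m"
    and act_act: "cmod c = 1 \<Longrightarrow> cmod d = 1 \<Longrightarrow> m \<in> M \<Longrightarrow> act c (act d m) = act (c * d) m"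
    and act_isometry:
      "cmod c = 1 \<Longrightarrow> m \<in> M \<Longrightarrow> n \<in> M \<Longrightarrow> dist (act c m) (act c n) = dist m n"
    and act_base: "cmod c = 1 \<Longrightarrow> act c z = z"

definition circle_kernel ::
  "'m::metric_space set \<Rightarrow> 'm \<Rightarrow> (complex \<Rightarrow> 'm \<Rightarrow> 'm) \<Rightarrow> (('m \<Rightarrow> real) \<Rightarrow> real) set" where
  "circle_kernel M z act = dual_closure M z (span
     {delta M z (act (cis \<theta>) m) - cos \<theta> *\<^sub>R delta M z m - sin \<theta> *\<^sub>R delta M z (act \<i> m)
      | m \<theta>. m \<in> M})"

text \<open>Elements of the quotient are cosets, i.e. sets of functionals; the coset \<open>\<phi> + Y\<close> is
  written \<open>\<phi> +o Y\<close>, and the sum of two cosets is their Minkowski sum.\<close>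

definition fc_proj ::
  "'m::metric_space set \<Rightarrow> 'm \<Rightarrow> (complex \<Rightarrow> 'm \<Rightarrow> 'm) \<Rightarrow>
   (('m \<Rightarrow> real) \<Rightarrow> real) \<Rightarrow> (('m \<Rightarrow> real) \<Rightarrow> real) set" where
  "fc_proj M z act \<phi> = \<phi> +o circle_kernel M z act"

definition fc_space ::
  "'m::metric_space set \<Rightarrow> 'm \<Rightarrow> (complex \<Rightarrow> 'm \<Rightarrow> 'm) \<Rightarrow> (('m \<Rightarrow> real) \<Rightarrow> real) set set" where
  "fc_space M z act = fc_proj M z act ` free_space M z"

definition fc_delta ::
  "'m::metric_space set \<Rightarrow> 'm \<Rightarrow> (complex \<Rightarrow> 'm \<Rightarrow> 'm) \<Rightarrow> 'm \<Rightarrow> (('m \<Rightarrow> real) \<Rightarrow> real) set" where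
  "fc_delta M z act m = fc_proj M z act (delta M z m)"

definition fc_norm ::
  "'m::metric_space set \<Rightarrow> 'm \<Rightarrow> (('m \<Rightarrow> real) \<Rightarrow> real) set \<Rightarrow> real" where
  "fc_norm M z A = (INF \<phi>\<in>A. dual_norm M z \<phi>)"

text \<open>The set of all differences of representatives of two cosets is the difference of the
  cosets in the quotient.\<close>

definition fc_dist ::
  "'m::metric_space set \<Rightarrow> 'm \<Rightarrow>
   (('m \<Rightarrow> real) \<Rightarrow> real) set \<Rightarrow> (('m \<Rightarrow> real) \<Rightarrow> real) set \<Rightarrow> real" where
  "fc_dist M z A B = fc_norm M z {\<phi> - \<psi> | \<phi> \<psi>. \<phi> \<in> A \<and> \<psi> \<in> B}"

text \<open>The linear isometry of the dual of \<open>lip0 M z\<close> determined by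
  \<open>delta M z m \<mapsto> delta M z (g m)\<close>, for an isometry \<open>g\<close> of \<open>M\<close> fixing \<open>z\<close>.\<close>

definition push ::
  "'m::metric_space set \<Rightarrow> 'm \<Rightarrow> ('m \<Rightarrow> 'm) \<Rightarrow>
   (('m \<Rightarrow> real) \<Rightarrow> real) \<Rightarrow> (('m \<Rightarrow> real) \<Rightarrow> real)" where
  "push M z g \<phi> =
     (\<lambda>f. if f \<in> lip0 M z then \<phi> (\<lambda>x. if x \<in> M then f (g x) else 0) else 0)"

text \<open>Multiplication by \<open>\<i>\<close> is induced by \<open>push M z (act \<i>)\<close>; see \<open>fc_scaleC_proj\<close> and
  \<open>fc_scaleC_delta\<close> below.\<close>

definition fc_scaleC ::
  "'m::metric_space set \<Rightarrow> 'm \<Rightarrow> (complex \<Rightarrow> 'm \<Rightarrow> 'm) \<Rightarrow> complex \<Rightarrow>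
   (('m \<Rightarrow> real) \<Rightarrow> real) set \<Rightarrow> (('m \<Rightarrow> real) \<Rightarrow> real) set" where
  "fc_scaleC M z act c A =
     (\<Union>\<phi>\<in>A. fc_proj M z act (Re c *\<^sub>R \<phi> + Im c *\<^sub>R push M z (act \<i>) \<phi>))"

definition fc_bounded_clinear ::
  "'m::metric_space set \<Rightarrow> 'm \<Rightarrow> (complex \<Rightarrow> 'm \<Rightarrow> 'm) \<Rightarrow>
   ((('m \<Rightarrow> real) \<Rightarrow> real) set \<Rightarrow> 'y::complex_normed_vector) \<Rightarrow> bool" where
  "fc_bounded_clinear M z act T \<longleftrightarrow>
     (\<forall>A\<in>fc_space M z act. \<forall>B\<in>fc_space M z act. T (A + B) = T A + T B) \<and>
     (\<forall>c. \<forall>A\<in>fc_space M z act. T (fc_scaleC M z act c A) = c *\<^sub>C T A) \<and>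
     (\<exists>K. \<forall>A\<in>fc_space M z act. norm (T A) \<le> K * fc_norm M z A)"

definition fc_onorm ::
  "'m::metric_space set \<Rightarrow> 'm \<Rightarrow> (complex \<Rightarrow> 'm \<Rightarrow> 'm) \<Rightarrow>
   ((('m \<Rightarrow> real) \<Rightarrow> real) set \<Rightarrow> 'y::real_normed_vector) \<Rightarrow> real" where
  "fc_onorm M z act T = (SUP A\<in>{A \<in> fc_space M z act. fc_norm M z A \<le> 1}. norm (T A))"

definition circle_equivariant ::
  "'m set \<Rightarrow> (complex \<Rightarrow> 'm \<Rightarrow> 'm) \<Rightarrow> ('m \<Rightarrow> 'y::complex_normed_vector) \<Rightarrow> bool" where
  "circle_equivariant M act L \<longleftrightarrow> (\<forall>m\<in>M. \<forall>\<theta>. L (act (cis \<theta>) m) = cis \<theta> *\<^sub>C L m)"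


section \<open>The complex structure on the quotient is well defined\<close>

lemma isometric_circle_action_scaleC:
  fixes M :: "'x::complex_normed_vector set"
  assumes "0 \<in> M" and "\<And>c m. cmod c = 1 \<Longrightarrow> m \<in> M \<Longrightarrow> c *\<^sub>C m \<in> M"
  shows "isometric_circle_action M 0 (*\<^sub>C)"
proof
  have one: "1 *\<^sub>C x = x" for x :: 'x
    using scaleC_of_real[of 1 x] by simp
  have zero: "c *\<^sub>C (0::'x) = 0" for c
    using scaleC_add_right[of c 0 "0::'x"] by simp
  have minus: "c *\<^sub>C (x - y) = c *\<^sub>C x - c *\<^sub>C y" for c and x y :: 'x
    using scaleC_add_right[of c "x - y" y] by (simp add: algebra_simps)
  show "0 \<in> M" by fact
  show "c *\<^sub>C m \<in> M" if "cmod c = 1" "m \<in> M" for c m by (rule assms(2)[OF that])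
  show "1 *\<^sub>C m = m" for m :: 'x by (rule one)
  show "c *\<^sub>C d *\<^sub>C m = (c * d) *\<^sub>C m" for c d and m :: 'x by (rule scaleC_scaleC)
  show "dist (c *\<^sub>C m) (c *\<^sub>C n) = dist m n" if "cmod c = 1" for c and m n :: 'x
    by (simp add: dist_norm minus[symmetric] norm_scaleC that)
  show "c *\<^sub>C (0::'x) = 0" for c by (rule zero)
qed

lemma lipschitz_on_lip_const:
  assumes "\<exists>C. C-lipschitz_on M f"
  shows "(lip_const M f)-lipschitz_on M f"
proof (rule lipschitz_onI)
  let ?S = "{C. C-lipschitz_on M f}"
  have ne: "?S \<noteq> {}" using assms by auto
  show "0 \<le> lip_const M f"
    unfolding lip_const_def by (rule cInf_greatest[OF ne]) (auto dest: lipschitz_on_nonneg)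
  show "dist (f x) (f y) \<le> lip_const M f * dist x y" if "x \<in> M" "y \<in> M" for x y
  proof (cases "x = y")
    case False
    then have d: "dist x y > 0" by simp
    have "dist (f x) (f y) / dist x y \<le> lip_const M f"
      unfolding lip_const_def
    proof (rule cInf_greatest[OF ne])
      fix C assume "C \<in> ?S"
      then show "dist (f x) (f y) / dist x y \<le> C"
        using that d by (auto simp: lipschitz_on_def pos_divide_le_eq)
    qed
    then show ?thesis using d by (simp add: pos_divide_le_eq)
  qed auto
qed

lemma lip_const_le: "C-lipschitz_on M f \<Longrightarrow> lip_const M f \<le> C"
  unfolding lip_const_def
  by (rule cInf_lower) (auto simp: bdd_below_def intro: lipschitz_on_nonneg)

context isometric_circle_action
begin

abbreviation "J \<equiv> push M z (act \<i>)"
abbreviation "Y \<equiv> circle_kernel M z act"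

lemma zero_lip0: "0 \<in> lip0 M z" and zero_lip_const: "lip_const M (0 :: 'm \<Rightarrow> real) \<le> 1"
  by (auto simp: lip0_def lipschitz_on_def intro!: exI[of _ 0] lip_const_le)

lemma lip_const_nonneg: "f \<in> lip0 M z \<Longrightarrow> 0 \<le> lip_const M f"
  unfolding lip0_def by (blast intro: lipschitz_on_nonneg lipschitz_on_lip_const)

lemma dual_norm_bdd:
  assumes "\<phi> \<in> lip_dual M z"
  shows "bdd_above ((\<lambda>f. \<bar>\<phi> f\<bar>) ` {f \<in> lip0 M z. lip_const M f \<le> 1})"
proof -
  obtain K where K: "\<forall>f\<in>lip0 M z. \<bar>\<phi> f\<bar> \<le> K * lip_const M f"
    using assms unfolding lip_dual_def by auto
  have "\<bar>\<phi> f\<bar> \<le> \<bar>K\<bar>" if "f \<in> lip0 M z" "lip_const M f \<le> 1" for f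
  proof -
    have "lip_const M f \<ge> 0"
      by (rule lip_const_nonneg[OF that(1)])
    have "K * lip_const M f \<le> \<bar>K\<bar> * lip_const M f"
      using \<open>lip_const M f \<ge> 0\<close> by (intro mult_right_mono) auto
    also have "\<dots> \<le> \<bar>K\<bar>" using that(2) by (simp add: mult_left_le)
    finally show ?thesis using K that(1) by force
  qed
  then show ?thesis by (auto simp: bdd_above_def)
qed

lemma dual_norm_upper:
  "\<phi> \<in> lip_dual M z \<Longrightarrow> f \<in> lip0 M z \<Longrightarrow> lip_const M f \<le> 1 \<Longrightarrow> \<bar>\<phi> f\<bar> \<le> dual_norm M z \<phi>"
  unfolding dual_norm_def by (rule cSUP_upper) (auto intro: dual_norm_bdd)

lemma dual_norm_least:
  "(\<And>f. f \<in> lip0 M z \<Longrightarrow> lip_const M f \<le> 1 \<Longrightarrow> \<bar>\<phi> f\<bar> \<le> b) \<Longrightarrow> dual_norm M z \<phi> \<le> b"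
  unfolding dual_norm_def using zero_lip0 zero_lip_const by (intro cSUP_least) auto

lemma lip0_add: "f \<in> lip0 M z \<Longrightarrow> g \<in> lip0 M z \<Longrightarrow> f + g \<in> lip0 M z"
proof -
  assume f: "f \<in> lip0 M z" and g: "g \<in> lip0 M z"
  then obtain C D where "C-lipschitz_on M f" "D-lipschitz_on M g" by (auto simp: lip0_def)
  then have "(C + D)-lipschitz_on M (\<lambda>x. f x + g x)" by (rule lipschitz_on_add)
  then show ?thesis using f g by (auto simp: lip0_def plus_fun_def)
qed

lemma lip0_scaleR: "f \<in> lip0 M z \<Longrightarrow> r *\<^sub>R f \<in> lip0 M z"
proof -
  assume f: "f \<in> lip0 M z"
  then obtain C where "C-lipschitz_on M f" by (auto simp: lip0_def)
  then have "(\<bar>r\<bar> * C)-lipschitz_on M (\<lambda>x. r *\<^sub>R f x)" by (rule lipschitz_on_cmult)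
  then show ?thesis using f by (auto simp: lip0_def scaleR_fun_def)
qed

lemma lip_dual_subspace: "subspace (lip_dual M z)"
proof (rule subspaceI)
  show "0 \<in> lip_dual M z" by (auto simp: lip_dual_def intro: exI[of _ 0])
next
  fix \<phi> \<psi> assume a: "\<phi> \<in> lip_dual M z" "\<psi> \<in> lip_dual M z"
  then obtain K K' where K: "\<forall>f\<in>lip0 M z. \<bar>\<phi> f\<bar> \<le> K * lip_const M f"
    "\<forall>f\<in>lip0 M z. \<bar>\<psi> f\<bar> \<le> K' * lip_const M f"
    unfolding lip_dual_def by auto
  have "\<forall>f\<in>lip0 M z. \<bar>(\<phi> + \<psi>) f\<bar> \<le> (K + K') * lip_const M f"
    using K by (fastforce simp: distrib_right)
  then show "\<phi> + \<psi> \<in> lip_dual M z" using a by (auto simp: lip_dual_def distrib_left)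
next
  fix r \<phi> assume a: "\<phi> \<in> lip_dual M z"
  then obtain K where K: "\<forall>f\<in>lip0 M z. \<bar>\<phi> f\<bar> \<le> K * lip_const M f"
    unfolding lip_dual_def by auto
  have "\<forall>f\<in>lip0 M z. \<bar>(r *\<^sub>R \<phi>) f\<bar> \<le> (\<bar>r\<bar> * K) * lip_const M f"
    using K by (auto simp: abs_mult mult.assoc intro: mult_left_mono)
  then have "\<exists>K. \<forall>f\<in>lip0 M z. \<bar>(r *\<^sub>R \<phi>) f\<bar> \<le> K * lip_const M f" by blast
  then show "r *\<^sub>R \<phi> \<in> lip_dual M z" using a by (simp add: lip_dual_def algebra_simps)
qed

lemma delta_lip_dual: "m \<in> M \<Longrightarrow> delta M z m \<in> lip_dual M z"
proof -
  assume m: "m \<in> M"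
  have "\<bar>delta M z m f\<bar> \<le> dist m z * lip_const M f" if "f \<in> lip0 M z" for f
  proof -
    have "(lip_const M f)-lipschitz_on M f" "f z = 0"
      using that lipschitz_on_lip_const by (auto simp: lip0_def)
    then have "dist (f m) (f z) \<le> lip_const M f * dist m z"
      using m base by (blast intro: lipschitz_onD)
    then have "\<bar>f m\<bar> \<le> lip_const M f * dist m z"
      by (simp add: dist_real_def \<open>f z = 0\<close>)
    with that show ?thesis by (simp add: delta_def mult.commute)
  qed
  then show ?thesis
    using lip0_add lip0_scaleR by (auto simp: lip_dual_def delta_def)
qed

lemma dual_norm_triangle:
  assumes "\<phi> \<in> lip_dual M z" "\<psi> \<in> lip_dual M z"
  shows "dual_norm M z (\<phi> + \<psi>) \<le> dual_norm M z \<phi> + dual_norm M z \<psi>"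
proof (rule dual_norm_least)
  fix f assume "f \<in> lip0 M z" "lip_const M f \<le> 1"
  from dual_norm_upper[OF assms(1) this] dual_norm_upper[OF assms(2) this]
  show "\<bar>(\<phi> + \<psi>) f\<bar> \<le> dual_norm M z \<phi> + dual_norm M z \<psi>" by simp
qed

lemma dual_norm_scaleR:
  assumes "\<phi> \<in> lip_dual M z"
  shows "dual_norm M z (r *\<^sub>R \<phi>) \<le> \<bar>r\<bar> * dual_norm M z \<phi>"
  by (rule dual_norm_least) (auto simp: abs_mult intro!: mult_left_mono dual_norm_upper assms)

lemma dual_closure_subspace:
  assumes S: "subspace S" "S \<subseteq> lip_dual M z"
  shows "subspace (dual_closure M z S)"
proof (rule subspaceI)
  have "dual_norm M z 0 \<le> 0" by (rule dual_norm_least) auto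
  then show "0 \<in> dual_closure M z S"
    using S(1) subspace_0[OF lip_dual_subspace]
    by (auto simp: dual_closure_def intro!: bexI[of _ 0] subspace_0)
next
  fix \<phi> \<psi> assume a: "\<phi> \<in> dual_closure M z S" "\<psi> \<in> dual_closure M z S"
  then have d: "\<phi> \<in> lip_dual M z" "\<psi> \<in> lip_dual M z" by (auto simp: dual_closure_def)
  have "\<exists>\<xi>\<in>S. dual_norm M z (\<phi> + \<psi> - \<xi>) < \<epsilon>" if eps: "\<epsilon> > 0" for \<epsilon>
  proof -
    obtain u v where uv: "u \<in> S" "v \<in> S"
      "dual_norm M z (\<phi> - u) < \<epsilon>/2" "dual_norm M z (\<psi> - v) < \<epsilon>/2"
      using a half_gt_zero[OF eps] unfolding dual_closure_def by blast
    have "\<phi> - u \<in> lip_dual M z" "\<psi> - v \<in> lip_dual M z"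
      using d uv S by (auto intro!: subspace_diff[OF lip_dual_subspace])
    from dual_norm_triangle[OF this] uv
    have "dual_norm M z ((\<phi> + \<psi>) - (u + v)) < \<epsilon>" by (simp add: add_diff_add)
    then show ?thesis using uv subspace_add[OF S(1)] by blast
  qed
  then show "\<phi> + \<psi> \<in> dual_closure M z S"
    using subspace_add[OF lip_dual_subspace d] by (auto simp: dual_closure_def)
next
  fix r \<phi> assume a: "\<phi> \<in> dual_closure M z S"
  then have d: "\<phi> \<in> lip_dual M z" by (auto simp: dual_closure_def)
  have "\<exists>\<xi>\<in>S. dual_norm M z (r *\<^sub>R \<phi> - \<xi>) < \<epsilon>" if "\<epsilon> > 0" for \<epsilon>
  proof -
    have "\<epsilon> / (\<bar>r\<bar> + 1) > 0" using that by (simp add: add_nonneg_pos)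
    then obtain u where u: "u \<in> S" "dual_norm M z (\<phi> - u) < \<epsilon> / (\<bar>r\<bar> + 1)"
      using a unfolding dual_closure_def by blast
    have pd: "\<phi> - u \<in> lip_dual M z" using d u S by (auto intro!: subspace_diff[OF lip_dual_subspace])
    have "0 \<le> dual_norm M z (\<phi> - u)"
      using dual_norm_upper[OF pd zero_lip0 zero_lip_const] by linarith
    have "dual_norm M z (r *\<^sub>R \<phi> - r *\<^sub>R u) \<le> \<bar>r\<bar> * dual_norm M z (\<phi> - u)"
      using dual_norm_scaleR[OF pd, of r] by (simp add: scaleR_diff_right)
    also have "\<dots> \<le> (\<bar>r\<bar> + 1) * dual_norm M z (\<phi> - u)"
      using \<open>0 \<le> dual_norm M z (\<phi> - u)\<close> by (intro mult_right_mono) auto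
    also have "\<dots> < \<epsilon>" using u(2) by (simp add: pos_less_divide_eq add_nonneg_pos mult.commute)
    finally show ?thesis using u subspace_scale[OF S(1)] by blast
  qed
  then show "r *\<^sub>R \<phi> \<in> dual_closure M z S"
    using subspace_scale[OF lip_dual_subspace d] by (auto simp: dual_closure_def)
qed

abbreviation "gen m \<theta> \<equiv>
  delta M z (act (cis \<theta>) m) - cos \<theta> *\<^sub>R delta M z m - sin \<theta> *\<^sub>R delta M z (act \<i> m)"

lemma gen_lip_dual: "m \<in> M \<Longrightarrow> gen m \<theta> \<in> lip_dual M z"
  by (intro subspace_diff subspace_scale lip_dual_subspace delta_lip_dual act_closed) auto

lemma span_gen_lip_dual: "span {gen m \<theta> | m \<theta>. m \<in> M} \<subseteq> lip_dual M z"
  by (rule span_minimal[OF _ lip_dual_subspace]) (auto intro: gen_lip_dual)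

lemma subspace_circle_kernel: "subspace Y"
  unfolding circle_kernel_def by (rule dual_closure_subspace[OF subspace_span span_gen_lip_dual])

lemma delta_free_space: "m \<in> M \<Longrightarrow> delta M z m \<in> free_space M z"
proof -
  assume m: "m \<in> M"
  have "dual_norm M z 0 \<le> 0" by (rule dual_norm_least) auto
  then have "\<forall>\<epsilon>>0. \<exists>\<psi>\<in>span (delta M z ` M). dual_norm M z (delta M z m - \<psi>) < \<epsilon>"
    using m by (auto intro!: bexI[of _ "delta M z m"] span_base)
  with delta_lip_dual[OF m] show ?thesis by (auto simp: free_space_def dual_closure_def)
qed

lemma lip0_comp:
  assumes "f \<in> lip0 M z"
  shows "(\<lambda>x. if x \<in> M then f (act \<i> x) else 0) \<in> lip0 M z" (is "?g \<in> _")
    and "lip_const M (\<lambda>x. if x \<in> M then f (act \<i> x) else 0) \<le> lip_const M f"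
proof -
  have "(lip_const M f)-lipschitz_on M f"
    using assms by (intro lipschitz_on_lip_const) (auto simp: lip0_def)
  then have *: "(lip_const M f)-lipschitz_on M ?g"
    unfolding lipschitz_on_def using act_closed[of \<i>] act_isometry[of \<i>] by auto metis
  then show "lip_const M ?g \<le> lip_const M f" by (rule lip_const_le)
  show "?g \<in> lip0 M z" using * assms base act_base[of \<i>] by (auto simp: lip0_def)
qed

lemma push_linear:
  "J (\<phi> + \<psi>) = J \<phi> + J \<psi>" "J (r *\<^sub>R \<phi>) = r *\<^sub>R J \<phi>" "J (\<phi> - \<psi>) = J \<phi> - J \<psi>"
  by (auto simp: push_def fun_eq_iff)

lemma push_delta: "m \<in> M \<Longrightarrow> J (delta M z m) = delta M z (act \<i> m)"
  using lip0_comp(1) by (auto simp: push_def delta_def fun_eq_iff)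

lemma push_lip_dual:
  assumes "\<phi> \<in> lip_dual M z"
  shows "J \<phi> \<in> lip_dual M z"
proof -
  let ?c = "\<lambda>f x. if x \<in> M then f (act \<i> x) else (0::real)"
  have lin: "?c (f + g) = ?c f + ?c g" "?c (r *\<^sub>R f) = r *\<^sub>R ?c f" for f g r
    by (auto simp: fun_eq_iff)
  obtain K where K: "\<forall>f\<in>lip0 M z. \<bar>\<phi> f\<bar> \<le> K * lip_const M f"
    using assms unfolding lip_dual_def by auto
  have "\<bar>J \<phi> f\<bar> \<le> \<bar>K\<bar> * lip_const M f" if f: "f \<in> lip0 M z" for f
  proof -
    have nn: "0 \<le> lip_const M (?c f)"
      by (rule lip_const_nonneg[OF lip0_comp(1)[OF f]])
    have "\<bar>J \<phi> f\<bar> \<le> K * lip_const M (?c f)" using K lip0_comp(1)[OF f] f by (simp add: push_def)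
    also have "\<dots> \<le> \<bar>K\<bar> * lip_const M (?c f)" using nn by (intro mult_right_mono) auto
    also have "\<dots> \<le> \<bar>K\<bar> * lip_const M f" using lip0_comp(2)[OF f] by (intro mult_left_mono) auto
    finally show ?thesis .
  qed
  then have 1: "\<exists>K. \<forall>f\<in>lip0 M z. \<bar>J \<phi> f\<bar> \<le> K * lip_const M f" by blast
  have 2: "J \<phi> (f + g) = J \<phi> f + J \<phi> g" if f: "f \<in> lip0 M z" and g: "g \<in> lip0 M z" for f g
    unfolding push_def lin using f g lip0_add[OF f g] lip0_comp(1)[OF f] lip0_comp(1)[OF g] assms
    by (simp add: lip_dual_def)
  have 3: "J \<phi> (r *\<^sub>R f) = r * J \<phi> f" if f: "f \<in> lip0 M z" for r f
    unfolding push_def lin using f lip0_scaleR[OF f] lip0_comp(1)[OF f] assms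
    by (simp add: lip_dual_def)
  have 4: "J \<phi> f = 0" if "f \<notin> lip0 M z" for f
    using that by (simp add: push_def)
  from 1 2 3 4 show ?thesis unfolding lip_dual_def by blast
qed

lemma dual_norm_push:
  assumes "\<phi> \<in> lip_dual M z"
  shows "dual_norm M z (J \<phi>) \<le> dual_norm M z \<phi>"
proof (rule dual_norm_least)
  fix f assume f: "f \<in> lip0 M z" "lip_const M f \<le> 1"
  show "\<bar>J \<phi> f\<bar> \<le> dual_norm M z \<phi>"
    using dual_norm_upper[OF assms lip0_comp(1)[OF f(1)] order_trans[OF lip0_comp(2)[OF f(1)] f(2)]] f(1)
    by (simp add: push_def)
qed

lemma push_gen:
  assumes "m \<in> M"
  shows "J (gen m \<theta>) = gen (act \<i> m) \<theta>"
proof -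
  have "act (cis \<theta>) m \<in> M" "act \<i> m \<in> M" using assms by (auto intro: act_closed)
  moreover have "act \<i> (act (cis \<theta>) m) = act (cis \<theta>) (act \<i> m)"
    using assms by (subst (1 2) act_act) (auto simp: mult.commute)
  ultimately show ?thesis using assms by (simp only: push_linear push_delta)
qed

lemma push_circle_kernel:
  assumes "\<phi> \<in> Y"
  shows "J \<phi> \<in> Y"
proof -
  let ?G = "{gen m \<theta> | m \<theta>. m \<in> M}"
  have img: "J ` span ?G \<subseteq> span ?G"
  proof -
    have "linear J" by (rule linearI) (simp_all add: push_linear)
    then have "J ` span ?G = span (J ` ?G)" by (rule linear_span_image[symmetric])
    also have "J ` ?G \<subseteq> ?G"
    proof clarify
      fix m \<theta> assume "m \<in> M"
      then have "act \<i> m \<in> M" by (simp add: act_closed)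
      with push_gen[OF \<open>m \<in> M\<close>, of \<theta>]
      show "\<exists>m' \<theta>'. J (gen m \<theta>) = gen m' \<theta>' \<and> m' \<in> M" by blast
    qed
    then have "span (J ` ?G) \<subseteq> span ?G" by (rule span_mono)
    finally show ?thesis .
  qed
  have d: "\<phi> \<in> lip_dual M z" using assms by (auto simp: circle_kernel_def dual_closure_def)
  have contr: "dual_norm M z (J \<phi> - J \<psi>) \<le> dual_norm M z (\<phi> - \<psi>)" if "\<psi> \<in> span ?G" for \<psi>
    using dual_norm_push[OF subspace_diff[OF lip_dual_subspace d, of \<psi>]] that span_gen_lip_dual
    by (auto simp: push_linear)
  have "\<exists>\<xi>\<in>span ?G. dual_norm M z (J \<phi> - \<xi>) < \<epsilon>" if "\<epsilon> > 0" for \<epsilon>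
  proof -
    obtain \<psi> where "\<psi> \<in> span ?G" "dual_norm M z (\<phi> - \<psi>) < \<epsilon>"
      using assms \<open>\<epsilon> > 0\<close> unfolding circle_kernel_def dual_closure_def by blast
    with contr[of \<psi>] img show ?thesis by (intro bexI[of _ "J \<psi>"]) auto
  qed
  then show ?thesis
    using push_lip_dual[OF d] unfolding circle_kernel_def dual_closure_def by blast
qed

lemma fc_proj_eq_iff: "fc_proj M z act \<phi> = fc_proj M z act \<psi> \<longleftrightarrow> \<phi> - \<psi> \<in> Y"
proof
  assume "fc_proj M z act \<phi> = fc_proj M z act \<psi>"
  moreover have "\<phi> \<in> fc_proj M z act \<phi>"
    using subspace_0[OF subspace_circle_kernel] by (force simp: fc_proj_def elt_set_plus_def)
  ultimately show "\<phi> - \<psi> \<in> Y" by (auto simp: fc_proj_def elt_set_plus_def)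
next
  assume a: "\<phi> - \<psi> \<in> Y"
  show "fc_proj M z act \<phi> = fc_proj M z act \<psi>"
    unfolding fc_proj_def elt_set_plus_def
  proof (intro set_eqI iffI; clarify)
    fix y assume "y \<in> Y"
    then show "\<exists>b\<in>Y. \<phi> + y = \<psi> + b"
      using subspace_add[OF subspace_circle_kernel a]
      by (intro bexI[of _ "(\<phi> - \<psi>) + y"]) simp_all
  next
    fix y assume "y \<in> Y"
    then show "\<exists>b\<in>Y. \<psi> + y = \<phi> + b"
      using subspace_diff[OF subspace_circle_kernel _ a]
      by (intro bexI[of _ "y - (\<phi> - \<psi>)"]) simp_all
  qed
qed

lemma fc_proj_add: "fc_proj M z act \<phi> + fc_proj M z act \<psi> = fc_proj M z act (\<phi> + \<psi>)"
proof (intro set_eqI iffI)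
  fix \<xi> assume "\<xi> \<in> fc_proj M z act \<phi> + fc_proj M z act \<psi>"
  then obtain a b where "a \<in> Y" "b \<in> Y" "\<xi> = (\<phi> + a) + (\<psi> + b)"
    by (auto simp: fc_proj_def set_plus_def elt_set_plus_def)
  then show "\<xi> \<in> fc_proj M z act (\<phi> + \<psi>)"
    using subspace_add[OF subspace_circle_kernel]
    by (auto simp: fc_proj_def elt_set_plus_def algebra_simps intro!: bexI[of _ "a + b"])
next
  fix \<xi> assume "\<xi> \<in> fc_proj M z act (\<phi> + \<psi>)"
  then obtain a where a: "a \<in> Y" "\<xi> = (\<phi> + a) + (\<psi> + 0)"
    by (auto simp: fc_proj_def elt_set_plus_def algebra_simps)
  then show "\<xi> \<in> fc_proj M z act \<phi> + fc_proj M z act \<psi>"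
    unfolding fc_proj_def set_plus_def elt_set_plus_def
    using subspace_0[OF subspace_circle_kernel] by blast
qed

lemma fc_scaleC_proj:
  "fc_scaleC M z act c (fc_proj M z act \<phi>) = fc_proj M z act (Re c *\<^sub>R \<phi> + Im c *\<^sub>R J \<phi>)"
proof -
  have "fc_proj M z act (Re c *\<^sub>R \<psi> + Im c *\<^sub>R J \<psi>) = fc_proj M z act (Re c *\<^sub>R \<phi> + Im c *\<^sub>R J \<phi>)"
    if psi: "\<psi> \<in> fc_proj M z act \<phi>" for \<psi>
  proof -
    obtain y where y: "y \<in> Y" "\<psi> = \<phi> + y"
      using psi by (auto simp: fc_proj_def elt_set_plus_def)
    have "Re c *\<^sub>R y + Im c *\<^sub>R J y \<in> Y"
      using y(1) push_circle_kernel
      by (intro subspace_add subspace_scale subspace_circle_kernel) auto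
    moreover have "(Re c *\<^sub>R \<psi> + Im c *\<^sub>R J \<psi>) - (Re c *\<^sub>R \<phi> + Im c *\<^sub>R J \<phi>) =
        Re c *\<^sub>R y + Im c *\<^sub>R J y"
      by (simp add: y(2) push_linear scaleR_add_right)
    ultimately show ?thesis by (simp add: fc_proj_eq_iff)
  qed
  moreover have "\<phi> \<in> fc_proj M z act \<phi>"
    using subspace_0[OF subspace_circle_kernel] by (force simp: fc_proj_def elt_set_plus_def)
  ultimately show ?thesis unfolding fc_scaleC_def by blast
qed

lemma fc_scaleC_delta:
  "m \<in> M \<Longrightarrow> fc_scaleC M z act \<i> (fc_delta M z act m) = fc_delta M z act (act \<i> m)"
  by (simp add: fc_delta_def fc_scaleC_proj push_delta)

lemma fc_delta_equivariant:
  "m \<in> M \<Longrightarrow> fc_delta M z act (act (cis \<theta>) m) = fc_scaleC M z act (cis \<theta>) (fc_delta M z act m)"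
proof -
  assume m: "m \<in> M"
  have "dual_norm M z 0 \<le> 0" by (rule dual_norm_least) auto
  then have "\<forall>\<epsilon>>0. \<exists>\<psi>\<in>span {gen m \<theta> | m \<theta>. m \<in> M}. dual_norm M z (gen m \<theta> - \<psi>) < \<epsilon>"
    unfolding diff_self using m by (intro allI impI bexI[of _ "gen m \<theta>"] span_base) auto
  with gen_lip_dual[OF m, of \<theta>] have "gen m \<theta> \<in> Y"
    unfolding circle_kernel_def dual_closure_def by blast
  then show ?thesis
    by (simp only: fc_delta_def fc_scaleC_proj push_delta[OF m] fc_proj_eq_iff diff_diff_eq cis.sel)
qed

end

end

(* The norm of an element phi of the free space is the supremum of its values at 1-Lipschitz
   functions. For an equivariant L and a real-linear functional g of norm at most 1 on the target,
   g o L is such a function up to the factor Lip(L), and it vanishes on the generators of the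
   kernel. So the extension of L to cosets can be defined by g (T [phi]) = phi (g o L) for all g:
   uniqueness and the norm bound are Hahn-Banach, existence is density and completeness.
   The isometry statement is the bound for L = inclusion of M. *)
theory Submission
  imports Defs
begin

section \<open>Norming functionals\<close>

definition sublinear :: "('a::real_vector \<Rightarrow> real) \<Rightarrow> bool" where
  "sublinear p \<longleftrightarrow> (\<forall>x y. p (x + y) \<le> p x + p y) \<and> (\<forall>t\<ge>0. \<forall>x. p (t *\<^sub>R x) \<le> t * p x)"

lemma sublinear_add: "sublinear p \<Longrightarrow> p (x + y) \<le> p x + p y"
  and sublinear_scaleR_le: "sublinear p \<Longrightarrow> 0 \<le> t \<Longrightarrow> p (t *\<^sub>R x) \<le> t * p x"
  by (auto simp: sublinear_def)

lemma sublinear_zero: "sublinear p \<Longrightarrow> p 0 = 0"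
  using sublinear_add[of p 0 0] sublinear_scaleR_le[of p 0 0] by simp

lemma sublinear_scaleR:
  assumes "sublinear p" "0 \<le> t"
  shows "p (t *\<^sub>R x) = t * p x"
proof (cases "t = 0")
  case False
  then have "t > 0" using assms(2) by simp
  then have "t * p x \<le> p (t *\<^sub>R x)"
    using sublinear_scaleR_le[OF assms(1), of "1 / t" "t *\<^sub>R x"] by (simp add: field_simps)
  then show ?thesis using sublinear_scaleR_le[OF assms, of x] by simp
qed (simp add: sublinear_zero[OF assms(1)])

lemma sublinear_minus: "sublinear p \<Longrightarrow> - p (- x) \<le> p x"
  using sublinear_add[of p x "- x"] sublinear_zero[of p] by simp

lemma sublinear_norm: "sublinear (norm :: 'a::real_normed_vector \<Rightarrow> real)"
  by (auto simp: sublinear_def norm_triangle_ineq)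

text \<open>Hahn-Banach without extending functionals step by step: a minimal sublinear functional is
  linear, because \<open>x \<mapsto> inf\<^sub>t q (x + t y) - t q y\<close> lies below \<open>q\<close>.\<close>

lemma sublinear_descent:
  assumes q: "sublinear q"
  obtains p where "sublinear p" "\<And>x. p x \<le> q x" "\<And>x. p x \<le> q (x + y) - q y"
proof -
  define h where "h x t = q (x + t *\<^sub>R y) - t * q y" for x t
  define p where "p x = (INF t\<in>{0..}. h x t)" for x
  \<comment> \<open>Subadditivity on \<open>(x + t *\<^sub>R y) + (- x)\<close> bounds
    \<open>h x t\<close> below independently of \<open>t\<close>, so the infimum \<open>p x\<close>
    is finite.\<close>
  have low: "- q (- x) \<le> h x t" if "t \<ge> 0" for x t
    using sublinear_add[OF q, of "x + t *\<^sub>R y" "- x"] sublinear_scaleR[OF q that, of y]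
    by (simp add: h_def)
  have bdd: "bdd_below (h x ` {0..})" for x
    using low by (auto simp: bdd_below_def)
  have le: "p x \<le> h x t" if "t \<ge> 0" for x t
    unfolding p_def using that by (intro cINF_lower bdd) auto
  have ge: "b \<le> p x" if "\<And>t. t \<ge> 0 \<Longrightarrow> b \<le> h x t" for b x
    unfolding p_def using that by (intro cINF_greatest) auto
  have add: "p (x + x') \<le> p x + p x'" for x x'
  proof -
    have *: "p (x + x') \<le> h x t + h x' s" if "t \<ge> 0" "s \<ge> 0" for t s
    proof -
      have "p (x + x') \<le> h (x + x') (t + s)" using that by (intro le) simp
      also have "\<dots> \<le> h x t + h x' s"
        using sublinear_add[OF q, of "x + t *\<^sub>R y" "x' + s *\<^sub>R y"]
        by (simp add: h_def algebra_simps)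
      finally show ?thesis .
    qed
    have "p (x + x') - h x' s \<le> p x" if "s \<ge> 0" for s
      using *[OF _ that] by (intro ge) (simp add: algebra_simps)
    then have "p (x + x') - p x \<le> p x'" by (intro ge) (simp add: algebra_simps)
    then show ?thesis by simp
  qed
  have scale: "p (t *\<^sub>R x) \<le> t * p x" if "t \<ge> 0" for t x
  proof (cases "t = 0")
    case True
    then show ?thesis using le[of 0 0] by (simp add: h_def sublinear_zero[OF q])
  next
    case False
    then have t: "t > 0" using that by simp
    have "p (t *\<^sub>R x) / t \<le> p x"
    proof (rule ge)
      fix s :: real assume "s \<ge> 0"
      \<comment> \<open>With the parameter rescaled to \<open>t * s\<close>, the factor
        \<open>t\<close> comes out of \<open>h\<close>.\<close>
      then have "p (t *\<^sub>R x) \<le> h (t *\<^sub>R x) (t * s)" using that by (intro le) simp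
      also have "\<dots> = t * h x s"
        using sublinear_scaleR[OF q that, of "x + s *\<^sub>R y"] by (simp add: h_def algebra_simps)
      finally show "p (t *\<^sub>R x) / t \<le> h x s" using t by (simp add: field_simps)
    qed
    then show ?thesis using t by (simp add: field_simps)
  qed
  show thesis
  proof (rule that[of p])
    show "sublinear p" using add scale by (auto simp: sublinear_def)
    show "p x \<le> q x" for x using le[of 0 x] by (simp add: h_def)
    show "p x \<le> q (x + y) - q y" for x using le[of 1 x] by (simp add: h_def)
  qed
qed

lemma sublinear_minimal_linear:
  assumes q: "sublinear q" and min: "\<And>p. sublinear p \<Longrightarrow> p \<le> q \<Longrightarrow> p = q"
  shows "linear q"
proof -
  have "q x + q y \<le> q (x + y)" for x y
  proof -
    obtain p where "sublinear p" "\<And>x. p x \<le> q x" and p: "\<And>x. p x \<le> q (x + y) - q y"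
      using sublinear_descent[OF q] by metis
    \<comment> \<open>Once minimality identifies \<open>p\<close> with \<open>q\<close>, the bound
      \<open>p x \<le> q (x + y) - q y\<close> says that \<open>q\<close> is superadditive.\<close>
    then have "p = q" by (intro min) (auto simp: le_fun_def)
    with p[of x] show ?thesis by simp
  qed
  then have add: "q (x + y) = q x + q y" for x y
    using sublinear_add[OF q] by (simp add: order_antisym)
  have neg: "q (- x) = - q x" for x
    using add[of x "- x"] sublinear_zero[OF q] by simp
  have "q (r *\<^sub>R x) = r * q x" for r x
    using sublinear_scaleR[OF q, of r x] sublinear_scaleR[OF q, of "- r" x] neg[of "r *\<^sub>R x"]
    by (cases "r \<ge> 0") auto
  with add show ?thesis by (intro linearI) auto
qed

text \<open>Zorn's lemma for the sublinear functionals below \<open>p0\<close>: a nonempty chain has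
  its pointwise infimum as a lower bound, and a minimal element is linear.\<close>

lemma sublinear_dominates_linear:
  fixes p0 :: "'a::real_vector \<Rightarrow> real"
  assumes p0: "sublinear p0"
  obtains g where "linear g" "g \<le> p0"
proof -
  define A where "A = {p. sublinear p \<and> p \<le> p0}"
  \<comment> \<open>This bound is uniform over \<open>A\<close>, so pointwise infima over chains are
    finite.\<close>
  have low: "- p0 (- x) \<le> p x" if "p \<in> A" for p x
  proof -
    have "p (- x) \<le> p0 (- x)" "- p (- x) \<le> p x"
      using that sublinear_minus by (auto simp: A_def le_fun_def)
    then show ?thesis by simp
  qed
  \<comment> \<open>The order is reversed, so that Zorn's maximal element is minimal in the
    pointwise order.\<close>
  have "\<exists>m\<in>A. \<forall>a\<in>A. m \<ge> a \<longrightarrow> a = m"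
  proof (rule predicate_Zorn)
    show "partial_order_on A (relation_of (\<ge>) A)"
      by (rule partial_order_on_relation_ofI) auto
    fix C assume C: "C \<in> Chains (relation_of (\<ge>) A)"
    then have CA: "C \<subseteq> A" by (rule Chains_relation_of)
    have tot: "p \<le> p' \<or> p' \<le> p" if "p \<in> C" "p' \<in> C" for p p'
      using C that by (auto simp: Chains_def relation_of_def)
    show "\<exists>u\<in>A. \<forall>a\<in>C. a \<ge> u"
    proof (cases "C = {}")
      case True
      then show ?thesis using p0 by (auto simp: A_def)
    next
      case False
      define r where "r x = (INF p\<in>C. p x)" for x
      have bdd: "bdd_below ((\<lambda>p. p x) ` C)" for x
        using low CA by (fastforce simp: bdd_below_def)
      have le: "r x \<le> p x" if "p \<in> C" for p x
        unfolding r_def using that by (intro cINF_lower bdd)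
      have ge: "b \<le> r x" if "\<And>p. p \<in> C \<Longrightarrow> b \<le> p x" for b x
        unfolding r_def using that False by (intro cINF_greatest)
      have sub: "sublinear p" if "p \<in> C" for p using that CA by (auto simp: A_def)
      have add: "r (x + y) \<le> r x + r y" for x y
      proof -
        have *: "r (x + y) \<le> p x + p' y" if pp: "p \<in> C" "p' \<in> C" for p p'
        proof -
          \<comment> \<open>Of two members of the chain, the smaller one serves as \<open>s\<close>;
            its subadditivity controls the mixed sum.\<close>
          obtain s where s: "s \<in> C" "s \<le> p" "s \<le> p'" using tot[OF pp] pp by blast
          have "r (x + y) \<le> s (x + y)" by (rule le[OF s(1)])
          also have "\<dots> \<le> s x + s y" by (rule sublinear_add[OF sub[OF s(1)]])
          also have "\<dots> \<le> p x + p' y" using s by (intro add_mono) (auto simp: le_fun_def)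
          finally show ?thesis .
        qed
        have "r (x + y) - p' y \<le> r x" if "p' \<in> C" for p'
          using *[OF _ that] by (intro ge) (simp add: algebra_simps)
        then have "r (x + y) - r x \<le> r y" by (intro ge) (simp add: algebra_simps)
        then show ?thesis by simp
      qed
      have scale: "r (t *\<^sub>R x) \<le> t * r x" if "t \<ge> 0" for t x
      proof (cases "t = 0")
        case True
        obtain p where "p \<in> C" using False by blast
        with le[of p 0] sublinear_zero[OF sub, of p] True show ?thesis by simp
      next
        case tnz: False
        then have t: "t > 0" using that by simp
        have "r (t *\<^sub>R x) / t \<le> r x"
          using le sublinear_scaleR[OF sub that] t
          by (intro ge) (metis pos_divide_le_eq mult.commute)
        then show ?thesis using t by (simp add: field_simps)
      qed
      have "sublinear r" using add scale by (auto simp: sublinear_def)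
      moreover have "r \<le> p0"
      proof -
        obtain p where "p \<in> C" using False by blast
        then have "r \<le> p" "p \<le> p0" using le CA by (auto simp: le_fun_def A_def)
        then show ?thesis by (rule order_trans)
      qed
      ultimately show ?thesis using le by (auto simp: A_def le_fun_def intro!: bexI[of _ r])
    qed
  qed
  then obtain m where m: "m \<in> A" "\<And>a. a \<in> A \<Longrightarrow> a \<le> m \<Longrightarrow> a = m" by auto
  have "linear m"
  proof (rule sublinear_minimal_linear)
    show "sublinear m" using m(1) by (simp add: A_def)
    \<comment> \<open>Everything sublinear below \<open>m\<close> lies below \<open>p0\<close> and
      hence in \<open>A\<close>, so \<open>m\<close> is minimal among all sublinear
      functionals.\<close>
    show "p = m" if "sublinear p" "p \<le> m" for p
      using that m(1) by (intro m(2)) (auto simp: A_def intro: order_trans)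
  qed
  with m(1) show thesis by (intro that[of m]) (auto simp: A_def)
qed

section \<open>Contractive functionals norm and separate vectors\<close>

definition contractive_functional :: "('a::real_normed_vector \<Rightarrow> real) \<Rightarrow> bool" where
  "contractive_functional g \<longleftrightarrow> linear g \<and> (\<forall>x. \<bar>g x\<bar> \<le> norm x)"

text \<open>Descending from the norm in the direction \<open>y\<close> yields \<open>p\<close> with
  \<open>p (- y) \<le> - norm y\<close>. A linear \<open>g\<close> below \<open>p\<close> then
  satisfies \<open>g y \<ge> norm y\<close>, while \<open>p \<le> norm\<close> gives the opposite
  inequality.\<close>

lemma norming_functional:
  fixes y :: "'a::real_normed_vector"
  obtains g where "contractive_functional g" "g y = norm y"
proof -
  obtain p where p: "sublinear p" "\<And>x. p x \<le> norm x" "\<And>x. p x \<le> norm (x + y) - norm y"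
    using sublinear_descent[OF sublinear_norm, of y] by metis
  obtain g where g: "linear g" "g \<le> p" using sublinear_dominates_linear[OF p(1)] .
  have le: "g x \<le> norm x" for x
    using g(2) p(2)[of x] by (auto simp: le_fun_def intro: order_trans)
  have abs: "\<bar>g x\<bar> \<le> norm x" for x
    using le[of x] le[of "- x"] linear_neg[OF g(1), of x] by (simp add: abs_le_iff)
  have "g (- y) \<le> - norm y" using g(2) p(3)[of "- y"] by (force simp: le_fun_def intro: order_trans)
  then have "g y = norm y" using le[of y] linear_neg[OF g(1), of y] by simp
  with g(1) abs show thesis by (intro that[of g]) (auto simp: contractive_functional_def)
qed

lemma norm_le_functional:
  assumes "\<And>g. contractive_functional g \<Longrightarrow> g y \<le> b"
  shows "norm y \<le> b"
  by (metis assms norming_functional)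

lemma functional_separates:
  assumes "\<And>g. contractive_functional g \<Longrightarrow> g x = g y"
  shows "x = y"
proof -
  have "norm (x - y) \<le> 0"
    by (rule norm_le_functional) (simp add: assms contractive_functional_def linear_diff)
  then show ?thesis by simp
qed


section \<open>Extension of Lipschitz maps to the free space\<close>

text \<open>Multiplication by \<open>\<i>\<close> is a real-linear isometry. This is how real
  functionals see the complex structure.\<close>

lemma contractive_functional_scaleC_i:
  fixes g :: "'a::complex_normed_vector \<Rightarrow> real"
  assumes "contractive_functional g"
  shows "contractive_functional (\<lambda>y. g (\<i> *\<^sub>C y))"
proof -
  have "linear (\<lambda>y::'a. \<i> *\<^sub>C y)"
    by (rule linearI)
      (simp_all add: scaleC_add_right scaleC_of_real[symmetric] scaleC_scaleC mult.commute)
  then have "linear (\<lambda>y. g (\<i> *\<^sub>C y))"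
    using assms linear_compose[of "(*\<^sub>C) \<i>" g] by (simp add: contractive_functional_def o_def)
  moreover have "\<bar>g (\<i> *\<^sub>C y)\<bar> \<le> norm y" for y
    using assms norm_scaleC[of \<i> y] by (metis contractive_functional_def mult_1 norm_ii)
  ultimately show ?thesis by (simp add: contractive_functional_def)
qed

lemma scaleC_eq_scaleR:
  fixes y :: "'a::complex_normed_vector"
  shows "c *\<^sub>C y = Re c *\<^sub>R y + Im c *\<^sub>R (\<i> *\<^sub>C y)"
proof -
  have "c *\<^sub>C y = (complex_of_real (Re c) + complex_of_real (Im c) * \<i>) *\<^sub>C y"
    by (metis complex_eq mult.commute)
  then show ?thesis by (simp only: scaleC_add_left scaleC_scaleC[symmetric] scaleC_of_real)
qed

section \<open>Vectors represented by functionals on Lipschitz functions\<close>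

text \<open>The composite of \<open>g\<close> and \<open>L\<close> is cut off to zero outside
  \<open>M\<close>, as membership in \<open>lip0\<close> demands.\<close>

definition pullback :: "'m set \<Rightarrow> ('m \<Rightarrow> 'a) \<Rightarrow> ('a \<Rightarrow> real) \<Rightarrow> 'm \<Rightarrow> real" where
  "pullback M L g = (\<lambda>x. if x \<in> M then g (L x) else 0)"

text \<open>The unique \<open>y\<close> represented by \<open>\<phi>\<close> is the value at \<open>\<phi>\<close> of the linear extension of \<open>L\<close>.\<close>

definition represents ::
  "'m set \<Rightarrow> ('m \<Rightarrow> 'a::real_normed_vector) \<Rightarrow> (('m \<Rightarrow> real) \<Rightarrow> real) \<Rightarrow> 'a \<Rightarrow> bool" where
  "represents M L \<phi> y \<longleftrightarrow> (\<forall>g. contractive_functional g \<longrightarrow> g y = \<phi> (pullback M L g))"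

lemma represents_unique: "represents M L \<phi> x \<Longrightarrow> represents M L \<phi> y \<Longrightarrow> x = y"
  by (rule functional_separates) (metis represents_def)

lemma represents_zero: "represents M L 0 0"
  by (auto simp: represents_def contractive_functional_def linear_0)

lemma represents_add:
  "represents M L \<phi> x \<Longrightarrow> represents M L \<psi> y \<Longrightarrow> represents M L (\<phi> + \<psi>) (x + y)"
  by (auto simp: represents_def contractive_functional_def linear_add)

lemma represents_scaleR: "represents M L \<phi> x \<Longrightarrow> represents M L (r *\<^sub>R \<phi>) (r *\<^sub>R x)"
  by (auto simp: represents_def contractive_functional_def linear_scale)

lemma represents_diff:
  "represents M L \<phi> x \<Longrightarrow> represents M L \<psi> y \<Longrightarrow> represents M L (\<phi> - \<psi>) (x - y)"
  by (auto simp: represents_def contractive_functional_def linear_diff)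

section \<open>Estimates in the dual, the circle kernel and the quotient\<close>

context isometric_circle_action
begin

text \<open>For \<open>C > 0\<close>, divide \<open>f\<close> by \<open>C\<close>. For
  \<open>C = 0\<close>, \<open>f\<close> has Lipschitz constant zero and the boundedness clause of
  \<open>lip_dual\<close> forces \<open>\<phi> f = 0\<close>.\<close>

lemma lip_dual_bound:
  assumes \<phi>: "\<phi> \<in> lip_dual M z" and f: "f \<in> lip0 M z" "lip_const M f \<le> C"
  shows "\<bar>\<phi> f\<bar> \<le> C * dual_norm M z \<phi>"
proof (cases "C = 0")
  case True
  obtain K where "\<forall>f\<in>lip0 M z. \<bar>\<phi> f\<bar> \<le> K * lip_const M f"
    using \<phi> unfolding lip_dual_def by auto
  with f True lip_const_nonneg[OF f(1)] show ?thesis by force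
next
  case False
  then have C: "C > 0" using lip_const_nonneg[OF f(1)] f(2) by simp
  have "C-lipschitz_on M f"
    using f lipschitz_on_lip_const by (auto simp: lip0_def intro: lipschitz_on_le)
  then have "(\<bar>1 / C\<bar> * C)-lipschitz_on M (\<lambda>x. (1 / C) *\<^sub>R f x)" by (rule lipschitz_on_cmult)
  then have "lip_const M ((1 / C) *\<^sub>R f) \<le> 1"
    using C by (intro lip_const_le) (simp add: scaleR_fun_def)
  then have "\<bar>\<phi> ((1 / C) *\<^sub>R f)\<bar> \<le> dual_norm M z \<phi>"
    using \<phi> f lip0_scaleR by (intro dual_norm_upper)
  moreover have "\<phi> ((1 / C) *\<^sub>R f) = (1 / C) * \<phi> f"
    using \<phi> f unfolding lip_dual_def by blast
  ultimately show ?thesis using C by (simp add: abs_mult field_simps)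
qed

lemma dual_norm_nonneg: "\<phi> \<in> lip_dual M z \<Longrightarrow> 0 \<le> dual_norm M z \<phi>"
  using dual_norm_upper[OF _ zero_lip0 zero_lip_const] by (metis abs_ge_zero order_trans)

text \<open>Evaluation at a fixed \<open>f\<close> is continuous for the dual norm, so its vanishing
  on \<open>S\<close> passes to the closure.\<close>

lemma dual_closure_vanishes:
  assumes S: "S \<subseteq> lip_dual M z" and \<phi>: "\<phi> \<in> dual_closure M z S"
    and f: "f \<in> lip0 M z" and zero: "\<And>\<psi>. \<psi> \<in> S \<Longrightarrow> \<psi> f = 0"
  shows "\<phi> f = 0"
proof (rule ccontr)
  assume nz: "\<phi> f \<noteq> 0"
  \<comment> \<open>The summand 1 keeps \<open>C\<close> positive, so that division by it is
    possible.\<close>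
  define C where "C = lip_const M f + 1"
  have C: "C > 0" "lip_const M f \<le> C" using lip_const_nonneg[OF f] by (simp_all add: C_def)
  then have "\<bar>\<phi> f\<bar> / C > 0" using nz by simp
  then obtain \<psi> where \<psi>: "\<psi> \<in> S" "dual_norm M z (\<phi> - \<psi>) < \<bar>\<phi> f\<bar> / C"
    using \<phi> unfolding dual_closure_def by blast
  have "\<phi> - \<psi> \<in> lip_dual M z"
    using \<phi> \<psi>(1) S by (auto simp: dual_closure_def intro: subspace_diff[OF lip_dual_subspace])
  from lip_dual_bound[OF this f C(2)] have "\<bar>\<phi> f\<bar> \<le> C * dual_norm M z (\<phi> - \<psi>)"
    using zero[OF \<psi>(1)] by simp
  also have "\<dots> < \<bar>\<phi> f\<bar>" using \<psi>(2) C(1) by (simp add: field_simps)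
  finally show False by simp
qed

text \<open>Evaluation at \<open>f\<close> is linear, so vanishing passes from the generators to
  their span, and by continuity to the closure.\<close>

lemma circle_kernel_vanishes:
  assumes \<phi>: "\<phi> \<in> Y" and f: "f \<in> lip0 M z" and zero: "\<And>m \<theta>. m \<in> M \<Longrightarrow> gen m \<theta> f = 0"
  shows "\<phi> f = 0"
proof (rule dual_closure_vanishes[OF span_gen_lip_dual \<phi>[unfolded circle_kernel_def] f])
  have "subspace {\<psi>. \<psi> f = 0}" by (auto simp: subspace_def)
  moreover have "{gen m \<theta> | m \<theta>. m \<in> M} \<subseteq> {\<psi>. \<psi> f = 0}" using zero by blast
  ultimately have "span {gen m \<theta> | m \<theta>. m \<in> M} \<subseteq> {\<psi>. \<psi> f = 0}" by (rule span_minimal[rotated])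
  then show "\<psi> f = 0" if "\<psi> \<in> span {gen m \<theta> | m \<theta>. m \<in> M}" for \<psi> using that by blast
qed

lemma circle_kernel_lip_dual: "\<phi> \<in> Y \<Longrightarrow> \<phi> \<in> lip_dual M z"
  by (simp add: circle_kernel_def dual_closure_def)

lemma free_space_lip_dual: "\<phi> \<in> free_space M z \<Longrightarrow> \<phi> \<in> lip_dual M z"
  by (simp add: free_space_def dual_closure_def)

lemma subspace_free_space: "subspace (free_space M z)"
  unfolding free_space_def
  by (intro dual_closure_subspace subspace_span span_minimal lip_dual_subspace)
    (auto intro: delta_lip_dual)

lemma fc_proj_self: "\<phi> \<in> fc_proj M z act \<phi>"
  using subspace_0[OF subspace_circle_kernel] by (force simp: fc_proj_def elt_set_plus_def)

lemma fc_proj_lip_dual: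
  "\<phi> \<in> lip_dual M z \<Longrightarrow> \<psi> \<in> fc_proj M z act \<phi> \<Longrightarrow> \<psi> \<in> lip_dual M z"
  using subspace_add[OF lip_dual_subspace] circle_kernel_lip_dual
  by (auto simp: fc_proj_def elt_set_plus_def)

lemma fc_norm_le_dual_norm:
  assumes "\<phi> \<in> lip_dual M z"
  shows "fc_norm M z (fc_proj M z act \<phi>) \<le> dual_norm M z \<phi>"
  unfolding fc_norm_def using fc_proj_lip_dual[OF assms] dual_norm_nonneg
  by (intro cINF_lower fc_proj_self) (auto simp: bdd_below_def)

lemma fc_norm_greatest:
  "(\<And>\<psi>. \<psi> \<in> fc_proj M z act \<phi> \<Longrightarrow> b \<le> dual_norm M z \<psi>) \<Longrightarrow> b \<le> fc_norm M z (fc_proj M z act \<phi>)"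
  unfolding fc_norm_def using fc_proj_self by (intro cINF_greatest) auto

text \<open>The kernel is a subspace, so differences of representatives stay in the coset of
  \<open>\<phi> - \<psi>\<close>; each element of that coset arises with \<open>\<psi>\<close>
  itself as second representative.\<close>

lemma fc_dist_proj:
  "fc_dist M z (fc_proj M z act \<phi>) (fc_proj M z act \<psi>) = fc_norm M z (fc_proj M z act (\<phi> - \<psi>))"
proof -
  have "{\<xi> - \<eta> | \<xi> \<eta>. \<xi> \<in> fc_proj M z act \<phi> \<and> \<eta> \<in> fc_proj M z act \<psi>} = fc_proj M z act (\<phi> - \<psi>)"
  proof (intro set_eqI iffI)
    fix \<xi> assume "\<xi> \<in> {\<xi> - \<eta> | \<xi> \<eta>. \<xi> \<in> fc_proj M z act \<phi> \<and> \<eta> \<in> fc_proj M z act \<psi>}"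
    then obtain a b where "a \<in> Y" "b \<in> Y" "\<xi> = (\<phi> + a) - (\<psi> + b)"
      by (auto simp: fc_proj_def elt_set_plus_def)
    then show "\<xi> \<in> fc_proj M z act (\<phi> - \<psi>)"
      using subspace_diff[OF subspace_circle_kernel]
      by (auto simp: fc_proj_def elt_set_plus_def algebra_simps intro!: bexI[of _ "a - b"])
  next
    fix \<xi> assume "\<xi> \<in> fc_proj M z act (\<phi> - \<psi>)"
    then obtain a where "a \<in> Y" and \<xi>: "\<xi> = (\<phi> + a) - \<psi>"
      by (auto simp: fc_proj_def elt_set_plus_def algebra_simps)
    then have "\<phi> + a \<in> fc_proj M z act \<phi>" by (auto simp: fc_proj_def elt_set_plus_def)
    then show "\<xi> \<in> {\<xi> - \<eta> | \<xi> \<eta>. \<xi> \<in> fc_proj M z act \<phi> \<and> \<eta> \<in> fc_proj M z act \<psi>}"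
      using fc_proj_self[of \<psi>] \<xi> by blast
  qed
  then show ?thesis by (simp add: fc_dist_def)
qed

text \<open>Serves both the upper estimate of the isometry and the construction of unit ball
  elements that test the operator norm.\<close>

lemma dual_norm_delta_diff:
  assumes "m \<in> M" "n \<in> M"
  shows "dual_norm M z (delta M z m - delta M z n) \<le> dist m n"
proof (rule dual_norm_least)
  fix f assume f: "f \<in> lip0 M z" "lip_const M f \<le> 1"
  then have "1-lipschitz_on M f"
    using lipschitz_on_lip_const by (auto simp: lip0_def intro: lipschitz_on_le)
  from lipschitz_onD[OF this assms] f(1) show "\<bar>(delta M z m - delta M z n) f\<bar> \<le> dist m n"
    by (simp add: delta_def dist_real_def)
qed

end

section \<open>The extension of an equivariant Lipschitz map to cosets\<close>

text \<open>Any Lipschitz constant is allowed as \<open>C\<close>, so that the same \<open>L\<close>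
  can later be reinterpreted with its least one.\<close>

locale equivariant_lipschitz = isometric_circle_action M z act
  for M :: "'m::metric_space set" and z act +
  fixes L :: "'m \<Rightarrow> 'y::complex_normed_vector" and C :: real
  assumes lip: "C-lipschitz_on M L"
    and equivariant: "circle_equivariant M act L"
    and L_base: "L z = 0"
begin

lemma pullback_lip0:
  assumes "contractive_functional g"
  shows "pullback M L g \<in> lip0 M z" and "lip_const M (pullback M L g) \<le> C"
proof -
  have g: "linear g" "\<bar>g x\<bar> \<le> norm x" for x using assms by (auto simp: contractive_functional_def)
  have *: "C-lipschitz_on M (pullback M L g)"
  proof (rule lipschitz_onI)
    fix x y assume xy: "x \<in> M" "y \<in> M"
    have "dist (pullback M L g x) (pullback M L g y) = \<bar>g (L x - L y)\<bar>"
      using xy by (simp add: pullback_def dist_real_def linear_diff[OF g(1)])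
    also have "\<dots> \<le> dist (L x) (L y)" using g(2) by (simp add: dist_norm)
    also have "\<dots> \<le> C * dist x y" by (rule lipschitz_onD[OF lip xy])
    finally show "dist (pullback M L g x) (pullback M L g y) \<le> C * dist x y" .
  qed (rule lipschitz_on_nonneg[OF lip])
  then show "lip_const M (pullback M L g) \<le> C" by (rule lip_const_le)
  show "pullback M L g \<in> lip0 M z"
    using * base L_base linear_0[OF g(1)] by (auto simp: lip0_def pullback_def)
qed

text \<open>Equivariance at the angle pi / 2.\<close>

lemma L_act_i: "m \<in> M \<Longrightarrow> L (act \<i> m) = \<i> *\<^sub>C L m"
  using equivariant cis_pi_half by (metis circle_equivariant_def)

text \<open>By equivariance, \<open>L (act (cis \<theta>) m)\<close> is the real combination of
  \<open>L m\<close> and \<open>L (act \<i> m)\<close> with coefficients \<open>cos \<theta>\<close>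
  and \<open>sin \<theta>\<close>, so a real-linear \<open>g\<close> after \<open>L\<close>
  annihilates every generator.\<close>

lemma circle_kernel_pullback:
  assumes "\<phi> \<in> Y" "contractive_functional g"
  shows "\<phi> (pullback M L g) = 0"
proof (rule circle_kernel_vanishes[OF assms(1) pullback_lip0(1)[OF assms(2)]])
  fix m \<theta> assume m: "m \<in> M"
  have "L (act (cis \<theta>) m) = cos \<theta> *\<^sub>R L m + sin \<theta> *\<^sub>R L (act \<i> m)"
    using equivariant m scaleC_eq_scaleR[of "cis \<theta>"] by (simp add: circle_equivariant_def L_act_i)
  moreover have "linear g" using assms(2) by (simp add: contractive_functional_def)
  ultimately show "gen m \<theta> (pullback M L g) = 0"
    using m pullback_lip0(1)[OF assms(2)] act_closed[of "cis \<theta>" m] act_closed[of \<i> m]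
    by (simp add: delta_def pullback_def linear_add linear_scale)
qed

lemma represents_delta: "m \<in> M \<Longrightarrow> represents M L (delta M z m) (L m)"
  \<comment> \<open>\<open>pullback\<close> must stay folded until its membership in
    \<open>lip0\<close> has resolved the conditional in \<open>delta\<close>.\<close>
  by (simp add: represents_def delta_def pullback_lip0(1)) (simp add: pullback_def)

text \<open>The norm of \<open>y\<close> is attained by a contractive \<open>g\<close>, and each
  pullback has Lipschitz constant at most \<open>C\<close>.\<close>

lemma represents_bound:
  assumes "\<phi> \<in> lip_dual M z" "represents M L \<phi> y"
  shows "norm y \<le> C * dual_norm M z \<phi>"
proof (rule norm_le_functional)
  fix g :: "'y \<Rightarrow> real" assume g: "contractive_functional g"
  with assms(2) have "g y = \<phi> (pullback M L g)" by (simp add: represents_def)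
  then show "g y \<le> C * dual_norm M z \<phi>"
    using lip_dual_bound[OF assms(1) pullback_lip0[OF g]] by simp
qed

text \<open>Kernel elements vanish on all pullbacks, so the represented vector depends only on the
  coset.\<close>

lemma represents_coset:
  assumes "represents M L \<phi> y" "\<psi> \<in> fc_proj M z act \<phi>"
  shows "represents M L \<psi> y"
  using assms circle_kernel_pullback by (auto simp: represents_def fc_proj_def elt_set_plus_def)

text \<open>Composing the pullback of \<open>g\<close> with the action of \<open>\<i>\<close> gives,
  by equivariance, the pullback of \<open>g\<close> after multiplication by \<open>\<i>\<close>,
  again a contractive functional.\<close>

lemma represents_push:
  assumes "represents M L \<phi> y"
  shows "represents M L (J \<phi>) (\<i> *\<^sub>C y)"
  unfolding represents_def
proof (intro allI impI)
  fix g :: "'y \<Rightarrow> real" assume g: "contractive_functional g"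
  have "(\<lambda>x. if x \<in> M then pullback M L g (act \<i> x) else 0) = pullback M L (\<lambda>y. g (\<i> *\<^sub>C y))"
    using act_closed[of \<i>] by (auto simp: pullback_def L_act_i)
  then have "J \<phi> (pullback M L g) = \<phi> (pullback M L (\<lambda>y. g (\<i> *\<^sub>C y)))"
    using pullback_lip0(1)[OF g] by (simp add: push_def)
  then show "g (\<i> *\<^sub>C y) = J \<phi> (pullback M L g)"
    using assms contractive_functional_scaleC_i[OF g] by (simp add: represents_def)
qed

definition ext :: "(('m \<Rightarrow> real) \<Rightarrow> real) set \<Rightarrow> 'y" where
  "ext A = (THE y. \<forall>\<phi>\<in>A. represents M L \<phi> y)"

lemma ext_eq:
  assumes "represents M L \<phi> y"
  shows "ext (fc_proj M z act \<phi>) = y"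
  unfolding ext_def using represents_coset[OF assms] fc_proj_self represents_unique
  by (intro the_equality) blast+

lemma ext_delta: "m \<in> M \<Longrightarrow> ext (fc_delta M z act m) = L m"
  unfolding fc_delta_def by (rule ext_eq[OF represents_delta])

end

section \<open>Existence of represented vectors on the whole free space\<close>

text \<open>Functionals that represent a vector form a subspace containing all
  \<open>delta M z m\<close>, hence their span. For a limit \<open>\<phi>\<close> of such
  functionals, \<open>represents_bound\<close> makes the represented vectors Cauchy, and
  completeness supplies the vector for \<open>\<phi>\<close>.\<close>

lemma (in equivariant_lipschitz) represents_free_space:
  assumes \<phi>: "\<phi> \<in> free_space M z" and complete: "complete (UNIV :: 'y set)"
  obtains y where "represents M L \<phi> y"
proof -
  let ?S = "span (delta M z ` M)"
  have S: "?S \<subseteq> lip_dual M z"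
    by (rule span_minimal[OF _ lip_dual_subspace]) (auto intro: delta_lip_dual)
  have "?S \<subseteq> {\<psi>. \<exists>y. represents M L \<psi> y}"
  proof (rule span_minimal)
    show "delta M z ` M \<subseteq> {\<psi>. \<exists>y. represents M L \<psi> y}" using represents_delta by blast
    show "subspace {\<psi>. \<exists>y. represents M L \<psi> y}"
      unfolding subspace_def using represents_zero represents_add represents_scaleR by blast
  qed
  moreover have "\<exists>\<psi>\<in>?S. dual_norm M z (\<phi> - \<psi>) < 1 / Suc n" for n
    using \<phi> unfolding free_space_def dual_closure_def by simp
  ultimately have "\<exists>\<psi> y. \<psi> \<in> ?S \<and> dual_norm M z (\<phi> - \<psi>) < 1 / Suc n \<and> represents M L \<psi> y" for n
    by blast
  then obtain u y where u: "\<And>n. u n \<in> ?S" "\<And>n. dual_norm M z (\<phi> - u n) < 1 / Suc n"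
    and y: "\<And>n. represents M L (u n) (y n)" by metis
  have C: "C \<ge> 0" by (rule lipschitz_on_nonneg[OF lip])
  have d: "\<phi> - u n \<in> lip_dual M z" for n
    using u(1) S free_space_lip_dual[OF \<phi>] by (blast intro: subspace_diff[OF lip_dual_subspace])
  have dist: "dist (y m) (y n) \<le> C * (1 / Suc m + 1 / Suc n)" for m n
  proof -
    have "u m - u n \<in> lip_dual M z" using u(1) S by (blast intro: subspace_diff[OF lip_dual_subspace])
    then have "dist (y m) (y n) \<le> C * dual_norm M z (u m - u n)"
      unfolding dist_norm by (rule represents_bound[OF _ represents_diff[OF y y]])
    \<comment> \<open>Both approximants are compared with \<open>\<phi>\<close>; the factor -1 fits
      the triangle inequality, which is stated for sums.\<close>
    also have "u m - u n = (-1) *\<^sub>R (\<phi> - u m) + (\<phi> - u n)" by simp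
    also have "dual_norm M z \<dots> \<le> dual_norm M z (\<phi> - u m) + dual_norm M z (\<phi> - u n)"
      using dual_norm_triangle[OF subspace_scale[OF lip_dual_subspace d[of m], of "-1"] d[of n]]
        dual_norm_scaleR[OF d[of m], of "-1"] by simp
    also have "\<dots> \<le> 1 / Suc m + 1 / Suc n" using u(2)[of m] u(2)[of n] by simp
    finally show ?thesis using C by (simp add: mult_left_mono)
  qed
  have "Cauchy y"
  proof (rule metric_CauchyI)
    fix e :: real assume e: "e > 0"
    have "(\<lambda>n. C * (1 / Suc n + 1 / Suc n)) \<longlonglongrightarrow> C * (0 + 0)"
      by (intro tendsto_intros LIMSEQ_Suc lim_1_over_n)
    then have "\<forall>\<^sub>F n in sequentially. C * (1 / Suc n + 1 / Suc n) < e"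
      using e by (intro order_tendstoD(2)) auto
    then obtain N where N: "C * (1 / Suc N + 1 / Suc N) < e" by (auto simp: eventually_sequentially)
    have "dist (y m) (y n) < e" if "m \<ge> N" "n \<ge> N" for m n
    proof -
      have "1 / Suc m + 1 / Suc n \<le> 1 / Suc N + 1 / Suc N"
        using that by (intro add_mono divide_left_mono) auto
      then show ?thesis using dist[of m n] N C by (meson mult_left_mono order_trans le_less_trans)
    qed
    then show "\<exists>N. \<forall>m\<ge>N. \<forall>n\<ge>N. dist (y m) (y n) < e" by blast
  qed
  then obtain l where l: "y \<longlonglongrightarrow> l" using complete by (auto simp: complete_def)
  have "represents M L \<phi> l"
    unfolding represents_def
  proof (intro allI impI)
    fix g :: "'y \<Rightarrow> real" assume g: "contractive_functional g"
    let ?f = "pullback M L g"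
    have lin: "linear g" and gle: "\<bar>g x\<bar> \<le> 1 * norm x" for x
      using g by (auto simp: contractive_functional_def)
    have "bounded_linear g"
      using lin gle by (auto simp: bounded_linear_def bounded_linear_axioms_def intro!: exI[of _ 1])
    \<comment> \<open>The numbers \<open>u n ?f\<close> equal \<open>g (y n)\<close> and so tend to
      \<open>g l\<close>. The dual norm estimate below shows that they also tend to
      \<open>\<phi> ?f\<close>.\<close>
    then have lim1: "(\<lambda>n. u n ?f) \<longlonglongrightarrow> g l"
      using bounded_linear.tendsto[OF _ l] y g by (simp add: represents_def)
    have "\<bar>u n ?f - \<phi> ?f\<bar> \<le> C * (1 / Suc n)" for n
    proof -
      have "\<bar>u n ?f - \<phi> ?f\<bar> \<le> C * dual_norm M z (\<phi> - u n)"
        using lip_dual_bound[OF d[of n] pullback_lip0[OF g]] by (simp add: abs_minus_commute)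
      also have "\<dots> \<le> C * (1 / Suc n)" using u(2)[of n] C by (intro mult_left_mono) auto
      finally show ?thesis .
    qed
    moreover have "(\<lambda>n. C * (1 / Suc n)) \<longlonglongrightarrow> 0"
      by (intro tendsto_mult_right_zero LIMSEQ_Suc lim_1_over_n)
    ultimately have "(\<lambda>n. u n ?f - \<phi> ?f) \<longlonglongrightarrow> 0"
      by (intro Lim_null_comparison[of "\<lambda>n. u n ?f - \<phi> ?f" "\<lambda>n. C * (1 / Suc n)"]) auto
    then have "(\<lambda>n. u n ?f) \<longlonglongrightarrow> \<phi> ?f" by (simp add: LIM_zero_iff)
    with lim1 show "g l = \<phi> ?f" by (rule LIMSEQ_unique)
  qed
  then show thesis by (rule that)
qed

section \<open>Linearity and norm of the extension for a complete target\<close>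

locale equivariant_lipschitz_complete = equivariant_lipschitz M z act L C
  for M :: "'m::metric_space set" and z act and L :: "'m \<Rightarrow> 'y::cbanach" and C
begin

lemma fc_space_represents:
  assumes "A \<in> fc_space M z act"
  obtains \<phi> y where "\<phi> \<in> free_space M z" "A = fc_proj M z act \<phi>" "represents M L \<phi> y"
  using assms represents_free_space complete_UNIV by (metis fc_space_def imageE)

text \<open>The estimate by \<open>C * dual_norm M z \<psi>\<close> holds for every representative
  \<open>\<psi>\<close>, hence for the infimum over the coset.\<close>

lemma ext_bound:
  assumes "A \<in> fc_space M z act"
  shows "norm (ext A) \<le> C * fc_norm M z A"
proof -
  obtain \<phi> y where \<phi>: "\<phi> \<in> free_space M z" "A = fc_proj M z act \<phi>" "represents M L \<phi> y"
    using fc_space_represents[OF assms] .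
  have *: "norm y \<le> C * dual_norm M z \<psi>" if "\<psi> \<in> fc_proj M z act \<phi>" for \<psi>
    using that represents_bound represents_coset[OF \<phi>(3)] fc_proj_lip_dual free_space_lip_dual[OF \<phi>(1)]
    by blast
  have "norm y \<le> C * fc_norm M z (fc_proj M z act \<phi>)"
  \<comment> \<open>Passing to the infimum goes through division by \<open>C\<close>; for
    \<open>C = 0\<close> the vector is zero.\<close>
  proof (cases "C = 0")
    case True
    then show ?thesis using *[OF fc_proj_self] by simp
  next
    case False
    then have C: "C > 0" using lipschitz_on_nonneg[OF lip] by simp
    have "norm y / C \<le> fc_norm M z (fc_proj M z act \<phi>)"
      using * C by (intro fc_norm_greatest) (simp add: pos_divide_le_eq mult.commute)
    then show ?thesis using C by (simp add: field_simps)
  qed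
  then show ?thesis using \<phi> ext_eq by simp
qed

text \<open>\<open>x + y\<close> and \<open>c *\<^sub>C x\<close> represent the corresponding
  combinations of functionals, so uniqueness makes them the values of \<open>ext\<close>.\<close>

lemma ext_bounded_clinear: "fc_bounded_clinear M z act ext"
  unfolding fc_bounded_clinear_def
proof (intro conjI ballI allI)
  fix A B assume "A \<in> fc_space M z act" "B \<in> fc_space M z act"
  then obtain \<phi> x \<psi> y where A: "A = fc_proj M z act \<phi>" "represents M L \<phi> x"
    and B: "B = fc_proj M z act \<psi>" "represents M L \<psi> y"
    by (metis fc_space_represents)
  show "ext (A + B) = ext A + ext B"
    using ext_eq[OF A(2)] ext_eq[OF B(2)] ext_eq[OF represents_add[OF A(2) B(2)]]
    by (simp add: A(1) B(1) fc_proj_add)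
next
  fix c A assume "A \<in> fc_space M z act"
  then obtain \<phi> x where A: "A = fc_proj M z act \<phi>" "represents M L \<phi> x"
    by (metis fc_space_represents)
  have "represents M L (Re c *\<^sub>R \<phi> + Im c *\<^sub>R J \<phi>) (c *\<^sub>C x)"
    unfolding scaleC_eq_scaleR[of c] by (intro represents_add represents_scaleR represents_push A(2))
  then show "ext (fc_scaleC M z act c A) = c *\<^sub>C ext A"
    using ext_eq[OF A(2)] ext_eq by (simp add: A(1) fc_scaleC_proj)
next
  show "\<exists>K. \<forall>A\<in>fc_space M z act. norm (ext A) \<le> K * fc_norm M z A"
    using ext_bound by blast
qed

text \<open>The upper bound is \<open>ext_bound\<close> for the least Lipschitz constant. The lower
  bound tests \<open>ext\<close> on normalized differences of two point evaluations.\<close>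

lemma fc_onorm_ext: "fc_onorm M z act ext = lip_const M L"
proof (rule order_antisym)
  have "(lip_const M L)-lipschitz_on M L" using lipschitz_on_lip_const lip by blast
  \<comment> \<open>\<open>ext\<close> does not involve \<open>C\<close>, so the reinterpretation
    concerns the same map.\<close>
  then interpret best: equivariant_lipschitz_complete M z act L "lip_const M L"
    using equivariant L_base by unfold_locales
  let ?B = "{A \<in> fc_space M z act. fc_norm M z A \<le> 1}"
  have le: "norm (ext A) \<le> lip_const M L" if "A \<in> ?B" for A
  proof -
    have "norm (ext A) \<le> lip_const M L * fc_norm M z A" using best.ext_bound that by simp
    also have "\<dots> \<le> lip_const M L * 1"
      using that lipschitz_on_nonneg[OF best.lip] by (intro mult_left_mono) auto
    finally show ?thesis by simp
  qed
  have proj_B: "fc_proj M z act \<phi> \<in> ?B" if "\<phi> \<in> free_space M z" "dual_norm M z \<phi> \<le> 1" for \<phi>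
    using that fc_norm_le_dual_norm[OF free_space_lip_dual[OF that(1)]] by (auto simp: fc_space_def)
  have "dual_norm M z 0 \<le> 1" by (rule dual_norm_least) auto
  \<comment> \<open>The zero coset makes the unit ball nonempty and shows that the supremum is
    nonnegative.\<close>
  then have zero: "fc_proj M z act 0 \<in> ?B"
    by (intro proj_B subspace_0[OF subspace_free_space])
  have upper: "norm (ext A) \<le> fc_onorm M z act ext" if "A \<in> ?B" for A
    unfolding fc_onorm_def using that le by (intro cSUP_upper) (auto simp: bdd_above_def)
  show "fc_onorm M z act ext \<le> lip_const M L"
    unfolding fc_onorm_def using zero le by (intro cSUP_least) blast+
  show "lip_const M L \<le> fc_onorm M z act ext"
  proof (rule lip_const_le, rule lipschitz_onI)
    show "0 \<le> fc_onorm M z act ext" using upper[OF zero] norm_ge_zero order_trans by blast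
    fix m n assume mn: "m \<in> M" "n \<in> M"
    show "dist (L m) (L n) \<le> fc_onorm M z act ext * dist m n"
    proof (cases "m = n")
      case False
      then have d: "dist m n > 0" by simp
      \<comment> \<open>This element has dual norm at most 1 and is sent to the difference quotient
        of \<open>L\<close>.\<close>
      let ?\<phi> = "(1 / dist m n) *\<^sub>R (delta M z m - delta M z n)"
      have free: "delta M z m - delta M z n \<in> free_space M z"
        using mn by (intro subspace_diff subspace_free_space delta_free_space)
      have "dual_norm M z ?\<phi> \<le> \<bar>1 / dist m n\<bar> * dual_norm M z (delta M z m - delta M z n)"
        by (rule dual_norm_scaleR[OF free_space_lip_dual[OF free]])
      also have "\<dots> \<le> \<bar>1 / dist m n\<bar> * dist m n"
        by (intro mult_left_mono dual_norm_delta_diff mn) simp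
      also have "\<dots> = 1" using d by simp
      finally have "fc_proj M z act ?\<phi> \<in> ?B"
        using free by (intro proj_B subspace_scale[OF subspace_free_space])
      from upper[OF this] have "norm ((1 / dist m n) *\<^sub>R (L m - L n)) \<le> fc_onorm M z act ext"
        using ext_eq[OF represents_scaleR[OF represents_diff[OF represents_delta represents_delta]]] mn
        by simp
      then have "dist (L m) (L n) / dist m n \<le> fc_onorm M z act ext"
        unfolding norm_scaleR by (simp add: dist_norm)
      then show ?thesis using d by (simp add: pos_divide_le_eq)
    qed simp
  qed
qed

end

section \<open>The isometry and the factorization\<close>

theorem mainTheorem3:
  fixes M :: "'x::cbanach set"
  assumes "0 \<in> M"
    and "\<And>c m. cmod c = 1 \<Longrightarrow> m \<in> M \<Longrightarrow> c *\<^sub>C m \<in> M"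
  shows "(\<forall>m\<in>M. \<forall>n\<in>M.
            fc_dist M 0 (fc_delta M 0 (*\<^sub>C) m) (fc_delta M 0 (*\<^sub>C) n) = dist m n) \<and>
         (\<forall>L :: 'x \<Rightarrow> 'y::cbanach.
            (\<exists>C. C-lipschitz_on M L) \<longrightarrow> circle_equivariant M (*\<^sub>C) L \<longrightarrow> L 0 = 0 \<longrightarrow>
            (\<exists>T. fc_bounded_clinear M 0 (*\<^sub>C) T \<and>
                 (\<forall>m\<in>M. L m = T (fc_delta M 0 (*\<^sub>C) m)) \<and>
                 fc_onorm M 0 (*\<^sub>C) T = lip_const M L))"
proof (intro conjI ballI allI impI)
  interpret isometric_circle_action M 0 "(*\<^sub>C)"
    by (rule isometric_circle_action_scaleC[OF assms])
  fix m n assume mn: "m \<in> M" "n \<in> M"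
  \<comment> \<open>The inclusion of \<open>M\<close> is equivariant and 1-Lipschitz. Its extension
    sends the coset of \<open>?\<phi>\<close> below to \<open>m - n\<close>, so
    \<open>ext_bound\<close> gives the lower estimate for the quotient distance.\<close>
  interpret incl: equivariant_lipschitz_complete M 0 "(*\<^sub>C)" "\<lambda>x. x" 1
    by unfold_locales (auto simp: circle_equivariant_def lipschitz_on_def)
  let ?\<phi> = "delta M 0 m - delta M 0 n"
  have free: "?\<phi> \<in> free_space M 0"
    using mn by (intro subspace_diff subspace_free_space delta_free_space)
  have "norm (incl.ext (fc_proj M 0 (*\<^sub>C) ?\<phi>)) \<le> fc_norm M 0 (fc_proj M 0 (*\<^sub>C) ?\<phi>)"
    using incl.ext_bound[of "fc_proj M 0 (*\<^sub>C) ?\<phi>"] free by (simp add: fc_space_def)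
  moreover have "incl.ext (fc_proj M 0 (*\<^sub>C) ?\<phi>) = m - n"
    using mn by (intro incl.ext_eq represents_diff incl.represents_delta)
  moreover have "fc_norm M 0 (fc_proj M 0 (*\<^sub>C) ?\<phi>) \<le> dist m n"
    using fc_norm_le_dual_norm[OF free_space_lip_dual[OF free]] dual_norm_delta_diff[OF mn]
    by (rule order_trans)
  ultimately show "fc_dist M 0 (fc_delta M 0 (*\<^sub>C) m) (fc_delta M 0 (*\<^sub>C) n) = dist m n"
    by (simp add: fc_delta_def fc_dist_proj dist_norm)
next
  interpret isometric_circle_action M 0 "(*\<^sub>C)"
    by (rule isometric_circle_action_scaleC[OF assms])
  fix L :: "'x \<Rightarrow> 'y"
  assume L: "\<exists>C. C-lipschitz_on M L" "circle_equivariant M (*\<^sub>C) L" "L 0 = 0"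
  then obtain C where "C-lipschitz_on M L" by blast
  then interpret equivariant_lipschitz_complete M 0 "(*\<^sub>C)" L C
    using L by unfold_locales
  show "\<exists>T. fc_bounded_clinear M 0 (*\<^sub>C) T \<and>
            (\<forall>m\<in>M. L m = T (fc_delta M 0 (*\<^sub>C) m)) \<and>
            fc_onorm M 0 (*\<^sub>C) T = lip_const M L"
    using ext_bounded_clinear ext_delta fc_onorm_ext by (intro exI[of _ ext]) auto
qed

end
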